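(* Let $d\ge 1$, $\varepsilon>0$, $\Delta t>0$, $\Omega=[-1,1]^d$. If $\Delta t\le \varepsilon^2$, then the backward Euler scheme for the Allen-Cahn equation is stable: for every given smooth $\phi^n:\Omega\to\mathbb{R}$ with $\frac{\partial \phi^n}{\partial \mathbf{n}}=0$ on $\partial\Omega$, there is at most one smooth function $\phi^{n+1}:\Omega\to\mathbb{R}$ satisfying $$\frac{\phi^{n+1}-\phi^n}{\Delta t}-\Delta\phi^{n+1}+\frac{1}{\varepsilon^2}\big((\phi^{n+1})^3-\phi^{n+1}\big)=0\ \text{ in }\Omega,\qquad \frac{\partial \phi^{n+1}}{\partial \mathbf{n}}=0\ \text{ on }\partial\Omega .$$
   Context: The Allen-Cahn equation is $\phi_t-\Delta\phi+\frac{1}{\varepsilon^2}(\phi^3-\phi)=0$ on $\Omega=[-1,1]^d$ with homogeneous Neumann boundary conditions. $\Delta$ applied to a function is the Laplacian in $x=(x_1,\dots,x_d)$; $\Delta t$ is a single symbol, the time step size. $\mathbf{n}$ is the unit outward normal; on the cube the condition $\frac{\partial\phi}{\partial\mathbf{n}}=0$ means $\partial_{x_i}\phi=0$ on each face $x_i=\pm1$. "Smooth" means $C^\infty$ up to the boundary. A scheme relating $\phi^n$ and $\phi^{n+1}$ is called stable if $\phi^{n+1}$ is unique given $\phi^n$. *)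

theory Defs
  imports "HOL-Analysis.Analysis"
begin

text \<open>
  A function on \<open>[-1,1]\<^sup>d\<close> is represented by a total function on \<open>real ^ 'd\<close>, of which only the
  values on the cube are ever used: every derivative below is taken within the cube. Up to the
  boundary these derivatives are unique, since the cube is convex with nonempty interior.
\<close>

definition cube :: "(real ^ 'd) set"
  where "cube = {x. \<forall>i. -1 \<le> x $ i \<and> x $ i \<le> 1}"

definition partial :: "'d \<Rightarrow> (real ^ 'd \<Rightarrow> real) \<Rightarrow> real ^ 'd \<Rightarrow> real"
  where "partial i u x = frechet_derivative u (at x within cube) (axis i 1)"

definition laplacian :: "(real ^ 'd \<Rightarrow> real) \<Rightarrow> real ^ 'd \<Rightarrow> real"
  where "laplacian u x = (\<Sum>i\<in>UNIV. partial i (partial i u) x)"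

primrec Ck_on_cube :: "nat \<Rightarrow> (real ^ 'd \<Rightarrow> real) \<Rightarrow> bool"
  where
    "Ck_on_cube 0 u \<longleftrightarrow> continuous_on cube u"
  | "Ck_on_cube (Suc k) u \<longleftrightarrow> u differentiable_on cube \<and> (\<forall>i. Ck_on_cube k (partial i u))"

definition smooth_on_cube :: "(real ^ 'd \<Rightarrow> real) \<Rightarrow> bool"
  where "smooth_on_cube u \<longleftrightarrow> (\<forall>k. Ck_on_cube k u)"

definition neumann :: "(real ^ 'd \<Rightarrow> real) \<Rightarrow> bool"
  where "neumann u \<longleftrightarrow> (\<forall>x\<in>cube. \<forall>i. x $ i = -1 \<or> x $ i = 1 \<longrightarrow> partial i u x = 0)"

text \<open>
  The first argument of a scheme is the given time level, the second one the new time level.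
\<close>

definition backward_euler ::
    "real \<Rightarrow> real \<Rightarrow> (real ^ 'd \<Rightarrow> real) \<Rightarrow> (real ^ 'd \<Rightarrow> real) \<Rightarrow> bool"
  where "backward_euler \<epsilon> dt u v \<longleftrightarrow>
    (\<forall>x\<in>cube. (v x - u x) / dt - laplacian v x + 1 / \<epsilon>\<^sup>2 * ((v x) ^ 3 - v x) = 0) \<and>
    neumann v"

definition stable_scheme ::
    "((real ^ 'd \<Rightarrow> real) \<Rightarrow> (real ^ 'd \<Rightarrow> real) \<Rightarrow> bool) \<Rightarrow> bool"
  where "stable_scheme S \<longleftrightarrow>
    (\<forall>u. smooth_on_cube u \<and> neumann u \<longrightarrow>
      (\<forall>v w. smooth_on_cube v \<and> S u v \<and> smooth_on_cube w \<and> S u w \<longrightarrow>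
        (\<forall>x\<in>cube. v x = w x)))"

end

theory Submission
  imports Defs
begin

text \<open>
  The scheme obeys a comparison principle. Let \<open>v\<close> and \<open>w\<close> be two solutions and let \<open>v - w\<close>
  attain its maximum over the cube at \<open>p\<close>. Then \<open>\<Delta>v \<le> \<Delta>w\<close> at \<open>p\<close>, even if \<open>p\<close> lies on the
  boundary: on the line through \<open>p\<close> parallel to the \<open>i\<close>-th axis, the first derivative of \<open>v - w\<close>
  vanishes at \<open>p\<close>, by Fermat's criterion if \<open>-1 < p\<^sub>i < 1\<close> and by the Neumann condition
  otherwise, and a positive second derivative would then contradict maximality, on whichever
  side of \<open>p\<close> the line continues in the cube. Subtracting the two equations at \<open>p\<close> gives,
  with \<open>z = v p - w p\<close>,
  \[ (1/dt - 1/\varepsilon^2)\, z + (v^2 + v w + w^2)\, z / \varepsilon^2 = \Delta v - \Delta w \le 0, \]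
  which is impossible for \<open>z > 0\<close>: the first term is nonnegative because \<open>dt \<le> \<epsilon>\<^sup>2\<close>, and the
  second is positive because \<open>v p \<noteq> w p\<close>. Hence \<open>v \<le> w\<close>, and equality follows by symmetry. The
  argument replaces the usual energy estimate, so that no integration by parts is needed.
\<close>

section \<open>The second derivative test on a closed interval\<close>

text \<open>The maximum may be attained at an endpoint; there the hypothesis that \<open>f'\<close> vanishes at \<open>c\<close>
  is essential.\<close>

lemma second_deriv_nonpos_at_max_Icc:
  fixes f f' :: "real \<Rightarrow> real"
  assumes ab: "a < b" and c: "c \<in> {a..b}"
    and f: "\<And>t. t \<in> {a..b} \<Longrightarrow> (f has_real_derivative f' t) (at t within {a..b})"
    and f': "(f' has_real_derivative D) (at c within {a..b})"
    and crit: "f' c = 0"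
    and max: "\<And>t. t \<in> {a..b} \<Longrightarrow> f t \<le> f c"
  shows "D \<le> 0"
proof (rule ccontr)
  assume "\<not> D \<le> 0"
  then have D: "D > 0" by simp
  have mvt: "\<exists>x\<in>{s<..<t}. f t - f s = f' x * (t - s)" if "s < t" "a \<le> s" "t \<le> b" for s t
  proof (rule mvt_simple[OF \<open>s < t\<close>])
    fix x assume "s \<le> x" "x \<le> t"
    then have "(f has_real_derivative f' x) (at x within {s..t})"
      using that by (intro DERIV_subset[OF f]) auto
    then show "(f has_derivative (*) (f' x)) (at x within {s..t})"
      by (simp add: has_field_derivative_def)
  qed
  show False
  proof (cases "c < b")
    case True
    obtain d where d: "d > 0" "\<And>h. h > 0 \<Longrightarrow> c + h \<in> {a..b} \<Longrightarrow> h < d \<Longrightarrow> f' c < f' (c + h)"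
      using has_real_derivative_pos_inc_right[OF f' D] by blast
    define t where "t = c + min (d / 2) (b - c)"
    have t: "c < t" "t < c + d" "t \<le> b" using True d(1) by (auto simp: t_def min_def)
    obtain x where x: "c < x" "x < t" "f t - f c = f' x * (t - c)"
      using mvt[of c t] t c by auto
    have "f' x > 0" using d(2)[of "x - c"] x t c crit by auto
    then have "f t > f c" using x t by (smt (verit) mult_pos_pos)
    then show False using max[of t] t c by auto
  next
    case False
    then have "a < c" using c ab by auto
    obtain d where d: "d > 0" "\<And>h. h > 0 \<Longrightarrow> c - h \<in> {a..b} \<Longrightarrow> h < d \<Longrightarrow> f' (c - h) < f' c"
      using has_real_derivative_pos_inc_left[OF f' D] by blast
    define t where "t = c - min (d / 2) (c - a)"
    have t: "t < c" "c - d < t" "a \<le> t" using \<open>a < c\<close> d(1) by (auto simp: t_def min_def)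
    obtain x where x: "t < x" "x < c" "f c - f t = f' x * (c - t)"
      using mvt[of t c] t c by auto
    have "f' x < 0" using d(2)[of "c - x"] x t c crit by auto
    then have "f t > f c" using x t by (smt (verit) mult_neg_pos)
    then show False using max[of t] t c by auto
  qed
qed

section \<open>Restriction to lines parallel to the axes\<close>

lemma compact_cube: "compact (cube :: (real ^ 'd) set)"
proof -
  have "(cube :: (real ^ 'd) set) = cbox (\<chi> i. -1) (\<chi> i. 1)"
    by (auto simp: cube_def mem_box_cart)
  then show ?thesis by (metis compact_cbox)
qed

text \<open>The line through \<open>x\<close> parallel to the \<open>i\<close>-th axis, parametrised by the \<open>i\<close>-th coordinate, so
  that it lies in the cube exactly for parameters in \<open>[-1,1]\<close> and reaches \<open>x\<close> at \<open>x $ i\<close>.\<close>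

definition axis_line :: "'d \<Rightarrow> real ^ 'd \<Rightarrow> real \<Rightarrow> real ^ 'd"
  where "axis_line i x t = x + (t - x $ i) *\<^sub>R axis i 1"

lemma axis_line_self: "axis_line i x (x $ i) = x"
  by (simp add: axis_line_def)

lemma axis_line_in_cube:
  assumes "x \<in> cube" "t \<in> {-1..1}"
  shows "axis_line i x t \<in> cube"
  using assms by (auto simp: cube_def axis_line_def axis_def)

lemma has_real_derivative_axis_line:
  assumes u: "u differentiable_on cube" and x: "x \<in> cube" and t: "t \<in> {-1..1}"
  shows "((\<lambda>s. u (axis_line i x s)) has_real_derivative partial i u (axis_line i x t))
    (at t within {-1..1})"
proof -
  let ?L = "axis_line i x"
  have L: "(?L has_derivative (\<lambda>h. h *\<^sub>R axis i 1)) (at t within {-1..1})"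
    unfolding axis_line_def by (auto intro!: derivative_eq_intros)
  have "(u has_derivative frechet_derivative u (at (?L t) within cube)) (at (?L t) within cube)"
    using u axis_line_in_cube[OF x t] by (simp add: differentiable_on_def frechet_derivative_works)
  then have U: "(u has_derivative frechet_derivative u (at (?L t) within cube))
      (at (?L t) within ?L ` {-1..1})"
    and lin: "linear (frechet_derivative u (at (?L t) within cube))"
    using axis_line_in_cube[OF x] by (auto intro: has_derivative_subset has_derivative_linear)
  have "((\<lambda>s. u (?L s)) has_derivative
      (\<lambda>h. frechet_derivative u (at (?L t) within cube) (h *\<^sub>R axis i 1))) (at t within {-1..1})"
    using diff_chain_within[OF L U] by (simp add: o_def)
  moreover have "(\<lambda>h. frechet_derivative u (at (?L t) within cube) (h *\<^sub>R axis i 1))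
      = (*) (partial i u (?L t))"
    using linear_scale[OF lin] by (auto simp: partial_def)
  ultimately show ?thesis by (simp add: has_field_derivative_def)
qed

lemma smooth_on_cubeD:
  assumes "smooth_on_cube u"
  shows "u differentiable_on cube" and "partial i u differentiable_on cube"
proof -
  have "Ck_on_cube (Suc (Suc 0)) u" using assms unfolding smooth_on_cube_def by blast
  then show "u differentiable_on cube" "partial i u differentiable_on cube" by auto
qed

section \<open>The comparison principle\<close>

lemma partial_partial_le_at_max:
  assumes sv: "smooth_on_cube v" and sw: "smooth_on_cube w"
    and nv: "neumann v" and nw: "neumann w"
    and p: "p \<in> cube" and max: "\<And>x. x \<in> cube \<Longrightarrow> v x - w x \<le> v p - w p"
  shows "partial i (partial i v) p \<le> partial i (partial i w) p"
proof -
  let ?L = "axis_line i p" and ?c = "p $ i"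
  define f where "f = (\<lambda>t. v (?L t) - w (?L t))"
  define f' where "f' = (\<lambda>t. partial i v (?L t) - partial i w (?L t))"
  have c: "?c \<in> {-1..1}" using p by (auto simp: cube_def)
  have f: "(f has_real_derivative f' t) (at t within {-1..1})" if "t \<in> {-1..1}" for t
    unfolding f_def f'_def
    by (intro DERIV_diff has_real_derivative_axis_line smooth_on_cubeD sv sw p that)
  have f': "(f' has_real_derivative partial i (partial i v) (?L ?c) - partial i (partial i w) (?L ?c))
      (at ?c within {-1..1})"
    unfolding f'_def
    by (intro DERIV_diff has_real_derivative_axis_line smooth_on_cubeD sv sw p c)
  have fmax: "f t \<le> f ?c" if "t \<in> {-1..1}" for t
    using max[OF axis_line_in_cube[OF p that]] by (simp add: f_def axis_line_self)
  have crit: "f' ?c = 0"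
  proof (cases "?c = -1 \<or> ?c = 1")
    case True
    then have "partial i v p = 0" "partial i w p = 0"
      using nv nw p unfolding neumann_def by blast+
    then show ?thesis by (simp add: f'_def axis_line_self)
  next
    case False
    then have int: "-1 < ?c" "?c < 1" using c by auto
    then have der: "(f has_real_derivative f' ?c) (at ?c)"
      using f[OF c] by (simp add: at_within_Icc_at)
    show ?thesis
    proof (rule DERIV_local_max[OF der])
      show "0 < min (?c + 1) (1 - ?c)" using int by simp
      show "\<forall>y. \<bar>?c - y\<bar> < min (?c + 1) (1 - ?c) \<longrightarrow> f y \<le> f ?c"
        by (intro allI impI fmax) (auto simp: abs_if split: if_splits)
    qed
  qed
  have "partial i (partial i v) (?L ?c) - partial i (partial i w) (?L ?c) \<le> 0"
    by (rule second_deriv_nonpos_at_max_Icc[OF _ c f f' crit fmax]) auto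
  then show ?thesis by (simp add: axis_line_self)
qed

lemma backward_euler_comparison:
  fixes u v w :: "real ^ 'd \<Rightarrow> real"
  assumes eps: "\<epsilon> > 0" and dt: "dt > 0" "dt \<le> \<epsilon>\<^sup>2"
    and sv: "smooth_on_cube v" and sw: "smooth_on_cube w"
    and ev: "backward_euler \<epsilon> dt u v" and ew: "backward_euler \<epsilon> dt u w"
    and x: "x \<in> cube"
  shows "v x \<le> w x"
proof -
  have "continuous_on cube (\<lambda>x. v x - w x)"
    by (intro continuous_on_diff differentiable_imp_continuous_on smooth_on_cubeD sv sw)
  then obtain p where p: "p \<in> cube" and max: "\<And>y. y \<in> cube \<Longrightarrow> v y - w y \<le> v p - w p"
    using continuous_attains_sup[OF compact_cube] x by blast
  have "neumann v" "neumann w" using ev ew by (auto simp: backward_euler_def)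
  then have lap: "laplacian v p \<le> laplacian w p"
    unfolding laplacian_def
    by (intro sum_mono partial_partial_le_at_max sv sw p max) auto
  have "v p \<le> w p"
  proof (rule ccontr)
    assume "\<not> v p \<le> w p"
    then have z: "v p - w p > 0" by simp
    have eqs: "(v p - u p) / dt - laplacian v p + 1 / \<epsilon>\<^sup>2 * ((v p) ^ 3 - v p) = 0"
      "(w p - u p) / dt - laplacian w p + 1 / \<epsilon>\<^sup>2 * ((w p) ^ 3 - w p) = 0"
      using ev ew p by (auto simp: backward_euler_def)
    have "(1 / dt - 1 / \<epsilon>\<^sup>2) * (v p - w p) + 1 / \<epsilon>\<^sup>2 * ((v p) ^ 3 - (w p) ^ 3)
        = laplacian v p - laplacian w p"
      using eqs by (simp add: diff_divide_distrib algebra_simps)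
    moreover have "(1 / dt - 1 / \<epsilon>\<^sup>2) * (v p - w p) \<ge> 0"
      using z dt by (intro mult_nonneg_nonneg) (auto simp: frac_le)
    moreover have "(v p) ^ 3 > (w p) ^ 3"
    proof -
      \<comment> \<open>The factor \<open>v\<^sup>2 + v w + w\<^sup>2\<close> of \<open>v\<^sup>3 - w\<^sup>3\<close> is \<open>(v\<^sup>2 + w\<^sup>2 + (v + w)\<^sup>2) / 2\<close>.\<close>
      have "(v p)\<^sup>2 + (w p)\<^sup>2 > 0"
        using z by (auto simp: sum_power2_gt_zero_iff)
      then have "((v p)\<^sup>2 + (w p)\<^sup>2 + (v p + w p)\<^sup>2) / 2 > 0"
        by (simp add: add_pos_nonneg)
      then have "(v p - w p) * (((v p)\<^sup>2 + (w p)\<^sup>2 + (v p + w p)\<^sup>2) / 2) > 0"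
        using z by (intro mult_pos_pos)
      then show ?thesis by (simp add: power2_eq_square power3_eq_cube field_simps)
    qed
    then have "1 / \<epsilon>\<^sup>2 * ((v p) ^ 3 - (w p) ^ 3) > 0"
      using eps by (intro mult_pos_pos) auto
    ultimately show False using lap by linarith
  qed
  then show ?thesis using max[OF x] by linarith
qed

theorem mainTheorem1:
  fixes \<epsilon> dt :: real
  assumes "\<epsilon> > 0" and "dt > 0" and "dt \<le> \<epsilon>\<^sup>2"
  shows "stable_scheme
    (backward_euler \<epsilon> dt :: (real ^ 'd \<Rightarrow> real) \<Rightarrow> (real ^ 'd \<Rightarrow> real) \<Rightarrow> bool)"
  unfolding stable_scheme_def
  by (auto intro!: antisym backward_euler_comparison[OF assms])

end
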